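(* Let $X$ be a set and let $\mathscr{A}$ and $\mathscr{B}$ be collections of families of subsets of $X$. If $X$ satisfies the principle $\mathbf{S}_{fin}^*(\mathscr{A},\mathscr{B})$, then $X$ satisfies the principle $\mathbf{CS}_{fin}(\mathscr{A},\mathscr{R}_{\mathscr{B}}^-)$.
   Context: For a set $Y$, $[Y]^{<\omega}$ is the collection of all finite subsets of $Y$ (including $\emptyset$; $\bigcup\emptyset=\emptyset$). For $A\subseteq X$ and a family $\mathcal{U}$ of subsets of $X$, $St(A,\mathcal{U})=\bigcup\{U\in\mathcal{U}:U\cap A\neq\emptyset\}$. For families $\mathcal{A},\mathcal{B}$ of sets, $\mathcal{A}$ refines $\mathcal{B}$, written $\mathcal{A}\prec\mathcal{B}$, if for every $A\in\mathcal{A}$ there is $B\in\mathcal{B}$ with $A\subseteq B$. For a collection $\mathscr{B}$ of families of subsets of $X$, $\mathscr{R}_{\mathscr{B}}^-=\{\mathcal{R}:\text{there exists }\mathcal{B}\in\mathscr{B}\text{ such that }\mathcal{R}\prec\mathcal{B}\}$, where $\mathcal{R}$ ranges over families of subsets of $X$. For collections $\mathscr{A},\mathscr{B}$ of families of subsets of $X$: $\mathbf{S}^*_{fin}(\mathscr{A},\mathscr{B})$: for any sequence $\{\mathcal{A}_n:n\in\omega\}$ of elements of $\mathscr{A}$ there is a sequence $\{\mathcal{B}_n:n\in\omega\}$ such that $\mathcal{B}_n$ is a finite subset of $\mathcal{A}_n$ for each $n\in\omega$, and $\bigcup_{n\in\omega}\{St(B,\mathcal{A}_n):B\in\mathcal{B}_n\}\in\mathscr{B}$.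 $\mathbf{CS}_{fin}(\mathscr{A},\mathscr{B})$: for any sequence $\{\mathcal{U}_n:n\in\omega\}$ of elements of $\mathscr{A}$ there is a sequence $\{\mathcal{U}_n^f:n\in\omega\}$ such that, for each $n\in\omega$, $\mathcal{U}_n^f=\{U_n^1,\dots,U_n^{k_n}\}$ is a finite subset of $\mathcal{U}_n$, and $\bigcup\{\mathcal{V}_n^i:n\in\omega\text{ and }i\in\{1,\dots,k_n\}\}\in\mathscr{B}$, where $\mathcal{V}_n^i=\{\bigcup\mathcal{V}:\mathcal{V}\in[\mathcal{U}_n]^{<\omega}\text{ and }U_n^i\cap V\neq\emptyset\text{ for each }V\in\mathcal{V}\}$. *)

theory Defs
  imports Main
begin

definition St :: "'a set \<Rightarrow> 'a set set \<Rightarrow> 'a set" where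
  "St A \<U> = \<Union>{U \<in> \<U>. U \<inter> A \<noteq> {}}"

definition refines :: "'a set set \<Rightarrow> 'a set set \<Rightarrow> bool" where
  "refines \<A> \<B> \<longleftrightarrow> (\<forall>A\<in>\<A>. \<exists>B\<in>\<B>. A \<subseteq> B)"

definition R_minus :: "'a set \<Rightarrow> 'a set set set \<Rightarrow> 'a set set set" where
  "R_minus X BB = {\<R>. \<R> \<subseteq> Pow X \<and> (\<exists>\<B>\<in>BB. refines \<R> \<B>)}"

definition S_star_fin :: "'a set set set \<Rightarrow> 'a set set set \<Rightarrow> bool" where
  "S_star_fin AA BB \<longleftrightarrow>
    (\<forall>\<A> :: nat \<Rightarrow> 'a set set. (\<forall>n. \<A> n \<in> AA) \<longrightarrow>
      (\<exists>\<B> :: nat \<Rightarrow> 'a set set. (\<forall>n. \<B> n \<in> Fpow (\<A> n)) \<and>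
        (\<Union>n. {St B (\<A> n) | B. B \<in> \<B> n}) \<in> BB))"

text \<open>The finite families \<open>\<F> n\<close> are the \<open>{U\<^sub>n\<^sup>1, \<dots>, U\<^sub>n\<^sup>k}\<close> of the usual
  formulation; as the family attached to the index \<open>i\<close> depends only on the set
  \<open>U\<^sub>n\<^sup>i\<close>, the union is indexed by the members \<open>U\<close> of \<open>\<F> n\<close> themselves.
  Both \<open>\<F> n\<close> and \<open>\<V>\<close> may be empty.\<close>

definition CS_fin :: "'a set set set \<Rightarrow> 'a set set set \<Rightarrow> bool" where
  "CS_fin AA BB \<longleftrightarrow>
    (\<forall>\<U> :: nat \<Rightarrow> 'a set set. (\<forall>n. \<U> n \<in> AA) \<longrightarrow>
      (\<exists>\<F> :: nat \<Rightarrow> 'a set set. (\<forall>n. \<F> n \<in> Fpow (\<U> n)) \<and>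
        (\<Union>n. \<Union>U\<in>\<F> n. {\<Union>\<V> | \<V>. \<V> \<in> Fpow (\<U> n) \<and> (\<forall>V\<in>\<V>. U \<inter> V \<noteq> {})}) \<in> BB))"

end

theory Submission
  imports Defs
begin

text \<open>The finite selections provided by \<open>S_star_fin\<close> also witness \<open>CS_fin\<close>: if every
  member of \<open>\<V> \<subseteq> \<U>\<close> meets \<open>U\<close>, then \<open>\<Union>\<V> \<subseteq> St U \<U>\<close>, so the family of all such
  unions refines the family of stars, which belongs to the target collection.\<close>

lemma Union_subset_St:
  assumes "\<V> \<subseteq> \<U>" and "\<forall>V\<in>\<V>. U \<inter> V \<noteq> {}"
  shows "\<Union>\<V> \<subseteq> St U \<U>"
  unfolding St_def
proof (rule Union_mono, rule subsetI)
  fix V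
  assume "V \<in> \<V>"
  with assms show "V \<in> {V \<in> \<U>. V \<inter> U \<noteq> {}}"
    by (auto simp: Int_commute)
qed

theorem theorem3p4:
  fixes X :: "'a set" and AA BB :: "'a set set set"
  assumes "AA \<subseteq> Pow (Pow X)" and "BB \<subseteq> Pow (Pow X)"
    and "S_star_fin AA BB"
  shows "CS_fin AA (R_minus X BB)"
  unfolding CS_fin_def
proof (intro allI impI)
  fix \<U> :: "nat \<Rightarrow> 'a set set"
  assume \<U>: "\<forall>n. \<U> n \<in> AA"
  have "\<exists>\<F>. (\<forall>n. \<F> n \<in> Fpow (\<U> n)) \<and> (\<Union>n. {St U (\<U> n) | U. U \<in> \<F> n}) \<in> BB"
    using assms(3)[unfolded S_star_fin_def, THEN spec[of _ \<U>]] \<U> by (rule mp)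
  then obtain \<F> where \<F>: "\<forall>n. \<F> n \<in> Fpow (\<U> n)"
    and stars: "(\<Union>n. {St U (\<U> n) | U. U \<in> \<F> n}) \<in> BB"
    by (elim exE conjE)
  let ?R = "\<Union>n. \<Union>U\<in>\<F> n. {\<Union>\<V> | \<V>. \<V> \<in> Fpow (\<U> n) \<and> (\<forall>V\<in>\<V>. U \<inter> V \<noteq> {})}"
  have sub: "\<U> n \<subseteq> Pow X" for n
    using \<U> assms(1) by auto
  have "?R \<subseteq> Pow X \<and> refines ?R (\<Union>n. {St U (\<U> n) | U. U \<in> \<F> n})"
    unfolding refines_def
  proof (intro conjI subsetI ballI)
    fix W
    assume "W \<in> ?R"
    then obtain n \<V> where W: "W = \<Union>\<V>" and "\<V> \<in> Fpow (\<U> n)"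
      by auto
    then have "\<V> \<subseteq> Pow X"
      using sub[of n] by (auto simp: Fpow_def)
    then show "W \<in> Pow X"
      unfolding W by auto
  next
    fix W
    assume "W \<in> ?R"
    then obtain n U \<V> where U: "U \<in> \<F> n" and W: "W = \<Union>\<V>"
      and \<V>: "\<V> \<in> Fpow (\<U> n)" "\<forall>V\<in>\<V>. U \<inter> V \<noteq> {}"
      by auto
    have "W \<subseteq> St U (\<U> n)"
      unfolding W using \<V> by (intro Union_subset_St) (simp_all add: Fpow_def)
    moreover have "St U (\<U> n) \<in> (\<Union>n. {St U (\<U> n) | U. U \<in> \<F> n})"
      using U by auto
    ultimately show "\<exists>B\<in>\<Union>n. {St U (\<U> n) | U. U \<in> \<F> n}. W \<subseteq> B"
      by (rule bexI)
  qed
  then have "?R \<in> R_minus X BB"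
    unfolding R_minus_def by (elim conjE) (intro CollectI conjI bexI[OF _ stars])
  with \<F> show "\<exists>\<F>. (\<forall>n. \<F> n \<in> Fpow (\<U> n)) \<and>
      (\<Union>n. \<Union>U\<in>\<F> n. {\<Union>\<V> | \<V>. \<V> \<in> Fpow (\<U> n) \<and> (\<forall>V\<in>\<V>. U \<inter> V \<noteq> {})}) \<in> R_minus X BB"
    by (intro exI conjI)
qed

end
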